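(* Let $P:\mathbb C^{\mathrm{op}}\to\mathbf{Pos}$ be a primary doctrine, $X$ an object of $\mathbb C$ and $\varphi\in P(X)$, and let $P_{(X,\varphi)}$ be the associated Kleisli doctrine with canonical 1-arrow $(F_X,\mathfrak f):P\to P_{(X,\varphi)}$. If $P$ is a universal doctrine, then $P_{(X,\varphi)}$ is a universal doctrine, and $(F_X,\mathfrak f)$ is a universal homomorphism. Additionally, if the universal quantifier of $P$ satisfies Frobenius reciprocity, then so does the universal quantifier of $P_{(X,\varphi)}$.
   Context: A doctrine is a functor $P:\mathbb C^{\mathrm{op}}\to\mathbf{Pos}$ with $\mathbb C$ a category with finite products and $\mathbf{Pos}$ the category of posets and monotone maps; the maps $P(f)$ are called reindexings. It is primary if every $P(A)$ has finite meets ($\wedge$, $\top$) and all reindexings preserve them. A 1-arrow (doctrine homomorphism) from $P:\mathbb C^{\mathrm{op}}\to\mathbf{Pos}$ to $R:\mathbb D^{\mathrm{op}}\to\mathbf{Pos}$ is a pair $(F,\mathfrak f)$ with $F:\mathbb C\to\mathbb D$ a finite-product-preserving functor and $\mathfrak f:P\to R\circ F^{\mathrm{op}}$ natural. A doctrine $P$ is universal if for all objects $B,C$ the map $P(\mathrm{pr}_1):P(C)\to P(C\times B)$ has a right adjoint $\forall^B_C:P(C\times B)\to P(C)$ satisfying Beck–Chevalley: $P(f)\forall^B_{C'}=\forall^B_CP(f\times\mathrm{id}_B)$ for every $f:C\to C'$. A homomorphism $(F,\mathfrak f)$ between universal doctrines is universal if $\mathfrak f_C\forall^B_C=\forall^{FB}_{FC}\mathfrak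 f_{C\times B}$ for all $B,C$. For a primary universal doctrine, Frobenius reciprocity for the universal quantifier means $P(\mathrm{pr}_1)(\gamma\wedge\forall^B_C(\beta))=P(\mathrm{pr}_1)(\gamma)\wedge\beta$ for all $B,C$, $\gamma\in P(C)$, $\beta\in P(C\times B)$. Kleisli doctrine (the Kleisli object of the comonad on $P$ given by $X\times-$ and $\alpha\mapsto P(\mathrm{pr}_1)(\varphi)\wedge P(\mathrm{pr}_2)(\alpha)$). The category $\mathbb C_X$ has the same objects as $\mathbb C$; an arrow $g:A\rightsquigarrow B$ in $\mathbb C_X$ is a $\mathbb C$-arrow $g:X\times A\to B$; the identity of $A$ is $\mathrm{pr}_2:X\times A\to A$; the composite of $g:A\rightsquigarrow B$ and $h:B\rightsquigarrow C$ is $h\langle\mathrm{pr}_1,g\rangle$. It has finite products, given on objects by those of $\mathbb C$. The doctrine $P_{(X,\varphi)}:\mathbb C_X^{\mathrm{op}}\to\mathbf{Pos}$ has $P_{(X,\varphi)}(A)=\{\alpha\in P(X\times A)\mid\alpha\le P(\mathrm{pr}_1)(\varphi)\}$ with the order of $P(X\times A)$, and reindexing along $g:A\rightsquigarrow B$ is the restriction of $P(\langle\mathrm{pr}_1,g\rangle)$. The 1-arrow $(F_X,\mathfrak f):P\to P_{(X,\varphi)}$: $F_X:\mathbb C\to\mathbb C_X$ is the identity on objects and sends $f:A\to B$ to $f\,\mathrm{pr}_2:A\rightsquigarrow B$; $\mathfrak f_A(\alpha)=P(\mathrm{pr}_1)(\varphi)\wedge P(\mathrm{pr}_2)(\alpha)$,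 for $\mathrm{pr}_1,\mathrm{pr}_2$ the projections from $X\times A$. *)

theory Defs
  imports "HOL-Algebra.Galois_Connection"
begin

section \<open>Categories with finite products\<close>

text \<open>
  Hom-sets are indexed by domain and codomain and need not be disjoint, so identities and
  composition take the objects involved as arguments. In the Kleisli category the same arrow of the
  base category may represent arrows with different domains.
  \<open>Comp C A B E g f\<close> is the composite of \<open>f : A \<rightarrow> B\<close> followed by \<open>g : B \<rightarrow> E\<close>.
\<close>

record ('o, 'm) cat =
  Obj :: "'o set"
  Hom :: "'o \<Rightarrow> 'o \<Rightarrow> 'm set"
  Id :: "'o \<Rightarrow> 'm"
  Comp :: "'o \<Rightarrow> 'o \<Rightarrow> 'o \<Rightarrow> 'm \<Rightarrow> 'm \<Rightarrow> 'm"

locale category =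
  fixes C :: "('o, 'm, 'z) cat_scheme"
  assumes Id_closed: "A \<in> Obj C \<Longrightarrow> Id C A \<in> Hom C A A"
    and Comp_closed:
      "\<lbrakk>A \<in> Obj C; B \<in> Obj C; E \<in> Obj C; f \<in> Hom C A B; g \<in> Hom C B E\<rbrakk>
        \<Longrightarrow> Comp C A B E g f \<in> Hom C A E"
    and Comp_Id_right:
      "\<lbrakk>A \<in> Obj C; B \<in> Obj C; f \<in> Hom C A B\<rbrakk> \<Longrightarrow> Comp C A A B f (Id C A) = f"
    and Comp_Id_left:
      "\<lbrakk>A \<in> Obj C; B \<in> Obj C; f \<in> Hom C A B\<rbrakk> \<Longrightarrow> Comp C A B B (Id C B) f = f"
    and Comp_assoc:
      "\<lbrakk>A \<in> Obj C; B \<in> Obj C; E \<in> Obj C; G \<in> Obj C;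
        f \<in> Hom C A B; g \<in> Hom C B E; h \<in> Hom C E G\<rbrakk>
        \<Longrightarrow> Comp C A E G h (Comp C A B E g f) = Comp C A B G (Comp C B E G h g) f"

definition is_terminal :: "('o, 'm, 'z) cat_scheme \<Rightarrow> 'o \<Rightarrow> bool" where
  "is_terminal C T \<longleftrightarrow> T \<in> Obj C \<and> (\<forall>A \<in> Obj C. \<exists>!f. f \<in> Hom C A T)"

definition is_product :: "('o, 'm, 'z) cat_scheme \<Rightarrow> 'o \<Rightarrow> 'o \<Rightarrow> 'o \<Rightarrow> 'm \<Rightarrow> 'm \<Rightarrow> bool" where
  "is_product C A B Q p q \<longleftrightarrow>
     A \<in> Obj C \<and> B \<in> Obj C \<and> Q \<in> Obj C \<and> p \<in> Hom C Q A \<and> q \<in> Hom C Q B \<and>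
     (\<forall>T \<in> Obj C. \<forall>f \<in> Hom C T A. \<forall>g \<in> Hom C T B.
        \<exists>!h. h \<in> Hom C T Q \<and> Comp C T Q A p h = f \<and> Comp C T Q B q h = g)"

text \<open>
  The arrow \<open>T \<rightarrow> Q\<close> induced by \<open>f : T \<rightarrow> A\<close> and \<open>g : T \<rightarrow> B\<close>, for a product cone
  \<open>p : Q \<rightarrow> A\<close>, \<open>q : Q \<rightarrow> B\<close>.
\<close>

definition induced ::
    "('o, 'm, 'z) cat_scheme \<Rightarrow> 'o \<Rightarrow> 'o \<Rightarrow> 'o \<Rightarrow> 'm \<Rightarrow> 'm \<Rightarrow> 'o \<Rightarrow> 'm \<Rightarrow> 'm \<Rightarrow> 'm" where
  "induced C A B Q p q T f g =
     (THE h. h \<in> Hom C T Q \<and> Comp C T Q A p h = f \<and> Comp C T Q B q h = g)"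

text \<open>Finite products are given by a chosen terminal object and chosen binary products.\<close>

record ('o, 'm) fpcat = "('o, 'm) cat" +
  One :: 'o
  Prod :: "'o \<Rightarrow> 'o \<Rightarrow> 'o"
  Pr1 :: "'o \<Rightarrow> 'o \<Rightarrow> 'm"
  Pr2 :: "'o \<Rightarrow> 'o \<Rightarrow> 'm"

locale finite_product_category = category C
  for C :: "('o, 'm, 'z) fpcat_scheme" +
  assumes One_terminal: "is_terminal C (One C)"
    and Prod_product:
      "\<lbrakk>A \<in> Obj C; B \<in> Obj C\<rbrakk> \<Longrightarrow> is_product C A B (Prod C A B) (Pr1 C A B) (Pr2 C A B)"

definition pairing ::
    "('o, 'm, 'z) fpcat_scheme \<Rightarrow> 'o \<Rightarrow> 'o \<Rightarrow> 'o \<Rightarrow> 'm \<Rightarrow> 'm \<Rightarrow> 'm" where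
  "pairing C T A B f g = induced C A B (Prod C A B) (Pr1 C A B) (Pr2 C A B) T f g"

text \<open>\<open>f \<times> g : A \<times> B \<rightarrow> A' \<times> B'\<close> for \<open>f : A \<rightarrow> A'\<close> and \<open>g : B \<rightarrow> B'\<close>.\<close>

definition prod_map ::
    "('o, 'm, 'z) fpcat_scheme \<Rightarrow> 'o \<Rightarrow> 'o \<Rightarrow> 'o \<Rightarrow> 'o \<Rightarrow> 'm \<Rightarrow> 'm \<Rightarrow> 'm" where
  "prod_map C A A' B B' f g =
     pairing C (Prod C A B) A' B'
       (Comp C (Prod C A B) A A' f (Pr1 C A B)) (Comp C (Prod C A B) B B' g (Pr2 C A B))"


section \<open>Doctrines\<close>

text \<open>
  For \<open>f : A \<rightarrow> B\<close> the reindexing \<open>P(f) : P(B) \<rightarrow> P(A)\<close> is \<open>reindex P A B f\<close>.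
\<close>

record ('o, 'm, 'p) doctrine =
  base :: "('o, 'm) fpcat"
  fib :: "'o \<Rightarrow> 'p gorder"
  reindex :: "'o \<Rightarrow> 'o \<Rightarrow> 'm \<Rightarrow> 'p \<Rightarrow> 'p"

locale doctrine =
  fixes P :: "('o, 'm, 'p) doctrine"
  assumes base_fp: "finite_product_category (base P)"
    and fib_poset: "A \<in> Obj (base P) \<Longrightarrow> partial_order (fib P A)"
    and reindex_closed:
      "\<lbrakk>A \<in> Obj (base P); B \<in> Obj (base P); f \<in> Hom (base P) A B\<rbrakk>
        \<Longrightarrow> reindex P A B f \<in> carrier (fib P B) \<rightarrow> carrier (fib P A)"
    and reindex_mono:
      "\<lbrakk>A \<in> Obj (base P); B \<in> Obj (base P); f \<in> Hom (base P) A B\<rbrakk>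
        \<Longrightarrow> isotone (fib P B) (fib P A) (reindex P A B f)"
    and reindex_Id:
      "\<lbrakk>A \<in> Obj (base P); \<alpha> \<in> carrier (fib P A)\<rbrakk> \<Longrightarrow> reindex P A A (Id (base P) A) \<alpha> = \<alpha>"
    and reindex_Comp:
      "\<lbrakk>A \<in> Obj (base P); B \<in> Obj (base P); E \<in> Obj (base P);
        f \<in> Hom (base P) A B; g \<in> Hom (base P) B E; \<alpha> \<in> carrier (fib P E)\<rbrakk>
        \<Longrightarrow> reindex P A E (Comp (base P) A B E g f) \<alpha> = reindex P A B f (reindex P B E g \<alpha>)"

locale primary_doctrine = doctrine +
  assumes fib_meet: "A \<in> Obj (base P) \<Longrightarrow> lower_semilattice (fib P A)"
    and fib_top: "A \<in> Obj (base P) \<Longrightarrow> weak_partial_order_top (fib P A)"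
    and reindex_meet:
      "\<lbrakk>A \<in> Obj (base P); B \<in> Obj (base P); f \<in> Hom (base P) A B;
        \<alpha> \<in> carrier (fib P B); \<beta> \<in> carrier (fib P B)\<rbrakk>
        \<Longrightarrow> reindex P A B f (\<alpha> \<sqinter>\<^bsub>fib P B\<^esub> \<beta>)
            = reindex P A B f \<alpha> \<sqinter>\<^bsub>fib P A\<^esub> reindex P A B f \<beta>"
    and reindex_top:
      "\<lbrakk>A \<in> Obj (base P); B \<in> Obj (base P); f \<in> Hom (base P) A B\<rbrakk>
        \<Longrightarrow> reindex P A B f \<top>\<^bsub>fib P B\<^esub> = \<top>\<^bsub>fib P A\<^esub>"


section \<open>Doctrine homomorphisms\<close>

text \<open>
  The component of the natural transformation at \<open>A\<close> is \<open>trans T A : P(A) \<rightarrow> R(F A)\<close>.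
\<close>

record ('o1, 'm1, 'p1, 'o2, 'm2, 'p2) doctrine_map =
  fobj :: "'o1 \<Rightarrow> 'o2"
  farr :: "'o1 \<Rightarrow> 'o1 \<Rightarrow> 'm1 \<Rightarrow> 'm2"
  trans :: "'o1 \<Rightarrow> 'p1 \<Rightarrow> 'p2"

definition is_functor ::
    "('o1, 'm1, 'z1) cat_scheme \<Rightarrow> ('o2, 'm2, 'z2) cat_scheme
      \<Rightarrow> ('o1 \<Rightarrow> 'o2) \<Rightarrow> ('o1 \<Rightarrow> 'o1 \<Rightarrow> 'm1 \<Rightarrow> 'm2) \<Rightarrow> bool" where
  "is_functor C D Fo Fa \<longleftrightarrow>
     (\<forall>A \<in> Obj C. Fo A \<in> Obj D) \<and>
     (\<forall>A \<in> Obj C. \<forall>B \<in> Obj C. \<forall>f \<in> Hom C A B. Fa A B f \<in> Hom D (Fo A) (Fo B)) \<and>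
     (\<forall>A \<in> Obj C. Fa A A (Id C A) = Id D (Fo A)) \<and>
     (\<forall>A \<in> Obj C. \<forall>B \<in> Obj C. \<forall>E \<in> Obj C. \<forall>f \<in> Hom C A B. \<forall>g \<in> Hom C B E.
        Fa A E (Comp C A B E g f) = Comp D (Fo A) (Fo B) (Fo E) (Fa B E g) (Fa A B f))"

definition preserves_finite_products ::
    "('o1, 'm1, 'z1) cat_scheme \<Rightarrow> ('o2, 'm2, 'z2) cat_scheme
      \<Rightarrow> ('o1 \<Rightarrow> 'o2) \<Rightarrow> ('o1 \<Rightarrow> 'o1 \<Rightarrow> 'm1 \<Rightarrow> 'm2) \<Rightarrow> bool" where
  "preserves_finite_products C D Fo Fa \<longleftrightarrow>
     (\<forall>T. is_terminal C T \<longrightarrow> is_terminal D (Fo T)) \<and>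
     (\<forall>A B Q p q. is_product C A B Q p q
        \<longrightarrow> is_product D (Fo A) (Fo B) (Fo Q) (Fa Q A p) (Fa Q B q))"

definition doctrine_hom ::
    "('o1, 'm1, 'p1) doctrine \<Rightarrow> ('o2, 'm2, 'p2) doctrine
      \<Rightarrow> ('o1, 'm1, 'p1, 'o2, 'm2, 'p2) doctrine_map \<Rightarrow> bool" where
  "doctrine_hom P R T \<longleftrightarrow>
     doctrine P \<and> doctrine R \<and>
     is_functor (base P) (base R) (fobj T) (farr T) \<and>
     preserves_finite_products (base P) (base R) (fobj T) (farr T) \<and>
     (\<forall>A \<in> Obj (base P).
        trans T A \<in> carrier (fib P A) \<rightarrow> carrier (fib R (fobj T A)) \<and>
        isotone (fib P A) (fib R (fobj T A)) (trans T A)) \<and>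
     (\<forall>A \<in> Obj (base P). \<forall>B \<in> Obj (base P). \<forall>f \<in> Hom (base P) A B. \<forall>\<beta> \<in> carrier (fib P B).
        trans T A (reindex P A B f \<beta>)
          = reindex R (fobj T A) (fobj T B) (farr T A B f) (trans T B \<beta>))"


section \<open>Universal quantifiers\<close>

text \<open>\<open>u\<close> is right adjoint to \<open>P(pr\<^sub>1) : P(C) \<rightarrow> P(C \<times> B)\<close>.\<close>

definition forall_adjoint ::
    "('o, 'm, 'p) doctrine \<Rightarrow> 'o \<Rightarrow> 'o \<Rightarrow> ('p \<Rightarrow> 'p) \<Rightarrow> bool" where
  "forall_adjoint P B C u \<longleftrightarrow>
     galois_connection
       \<lparr>orderA = fib P C,
        orderB = fib P (Prod (base P) C B),
        lower = reindex P (Prod (base P) C B) C (Pr1 (base P) C B),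
        upper = u\<rparr>"

text \<open>
  The quantifier \<open>\<forall>\<^sup>B\<^sub>C\<close>. A right adjoint is unique on the fibre \<open>P(C \<times> B)\<close>, so the choice only
  affects arguments outside it.
\<close>

definition forallq :: "('o, 'm, 'p) doctrine \<Rightarrow> 'o \<Rightarrow> 'o \<Rightarrow> 'p \<Rightarrow> 'p" where
  "forallq P B C = (SOME u. forall_adjoint P B C u)"

definition universal_doctrine :: "('o, 'm, 'p) doctrine \<Rightarrow> bool" where
  "universal_doctrine P \<longleftrightarrow>
     doctrine P \<and>
     (\<forall>B \<in> Obj (base P). \<forall>C \<in> Obj (base P). \<exists>u. forall_adjoint P B C u) \<and>
     (\<forall>B \<in> Obj (base P). \<forall>C \<in> Obj (base P). \<forall>C' \<in> Obj (base P). \<forall>f \<in> Hom (base P) C C'.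
        \<forall>\<beta> \<in> carrier (fib P (Prod (base P) C' B)).
          reindex P C C' f (forallq P B C' \<beta>)
            = forallq P B C
                (reindex P (Prod (base P) C B) (Prod (base P) C' B)
                   (prod_map (base P) C C' B B f (Id (base P) B)) \<beta>))"

text \<open>
  For a finite-product-preserving functor \<open>F\<close>, the canonical isomorphism
  \<open>F C \<times> F B \<rightarrow> F (C \<times> B)\<close>.
\<close>

definition prod_comparison ::
    "('o1, 'm1, 'z1) fpcat_scheme \<Rightarrow> ('o2, 'm2, 'z2) fpcat_scheme
      \<Rightarrow> ('o1 \<Rightarrow> 'o2) \<Rightarrow> ('o1 \<Rightarrow> 'o1 \<Rightarrow> 'm1 \<Rightarrow> 'm2) \<Rightarrow> 'o1 \<Rightarrow> 'o1 \<Rightarrow> 'm2" where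
  "prod_comparison C D Fo Fa A B =
     induced D (Fo A) (Fo B)
       (Fo (Prod C A B)) (Fa (Prod C A B) A (Pr1 C A B)) (Fa (Prod C A B) B (Pr2 C A B))
       (Prod D (Fo A) (Fo B)) (Pr1 D (Fo A) (Fo B)) (Pr2 D (Fo A) (Fo B))"

text \<open>
  \<open>trans T (C \<times> B)\<close> takes values in \<open>R(F (C \<times> B))\<close>, whereas the quantifier of \<open>R\<close> acts on
  \<open>R(F C \<times> F B)\<close>. The usual identification of these two fibres is made explicit by reindexing
  along the canonical isomorphism; products need not be preserved strictly.
\<close>

definition universal_hom ::
    "('o1, 'm1, 'p1) doctrine \<Rightarrow> ('o2, 'm2, 'p2) doctrine
      \<Rightarrow> ('o1, 'm1, 'p1, 'o2, 'm2, 'p2) doctrine_map \<Rightarrow> bool" where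
  "universal_hom P R T \<longleftrightarrow>
     universal_doctrine P \<and> universal_doctrine R \<and> doctrine_hom P R T \<and>
     (\<forall>B \<in> Obj (base P). \<forall>C \<in> Obj (base P). \<forall>\<beta> \<in> carrier (fib P (Prod (base P) C B)).
        trans T C (forallq P B C \<beta>)
          = forallq R (fobj T B) (fobj T C)
              (reindex R (Prod (base R) (fobj T C) (fobj T B)) (fobj T (Prod (base P) C B))
                 (prod_comparison (base P) (base R) (fobj T) (farr T) C B)
                 (trans T (Prod (base P) C B) \<beta>)))"

definition frobenius_forall :: "('o, 'm, 'p) doctrine \<Rightarrow> bool" where
  "frobenius_forall P \<longleftrightarrow>
     primary_doctrine P \<and> universal_doctrine P \<and>
     (\<forall>B \<in> Obj (base P). \<forall>C \<in> Obj (base P).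
        \<forall>\<gamma> \<in> carrier (fib P C). \<forall>\<beta> \<in> carrier (fib P (Prod (base P) C B)).
          reindex P (Prod (base P) C B) C (Pr1 (base P) C B) (\<gamma> \<sqinter>\<^bsub>fib P C\<^esub> forallq P B C \<beta>)
            = reindex P (Prod (base P) C B) C (Pr1 (base P) C B) \<gamma>
                \<sqinter>\<^bsub>fib P (Prod (base P) C B)\<^esub> \<beta>)"


section \<open>The Kleisli doctrine\<close>

definition kleisli_cat :: "('o, 'm) fpcat \<Rightarrow> 'o \<Rightarrow> ('o, 'm) fpcat" where
  "kleisli_cat C X =
     \<lparr>Obj = Obj C,
      Hom = (\<lambda>A B. Hom C (Prod C X A) B),
      Id = (\<lambda>A. Pr2 C X A),
      Comp = (\<lambda>A B E h g.
        Comp C (Prod C X A) (Prod C X B) E h (pairing C (Prod C X A) X B (Pr1 C X A) g)),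
      One = One C,
      Prod = Prod C,
      Pr1 = (\<lambda>A B. Comp C (Prod C X (Prod C A B)) (Prod C A B) A
               (Pr1 C A B) (Pr2 C X (Prod C A B))),
      Pr2 = (\<lambda>A B. Comp C (Prod C X (Prod C A B)) (Prod C A B) B
               (Pr2 C A B) (Pr2 C X (Prod C A B)))\<rparr>"

definition kleisli :: "('o, 'm, 'p) doctrine \<Rightarrow> 'o \<Rightarrow> 'p \<Rightarrow> ('o, 'm, 'p) doctrine" where
  "kleisli P X \<phi> =
     \<lparr>base = kleisli_cat (base P) X,
      fib = (\<lambda>A. (fib P (Prod (base P) X A))
        \<lparr>carrier := {\<alpha> \<in> carrier (fib P (Prod (base P) X A)).
           \<alpha> \<sqsubseteq>\<^bsub>fib P (Prod (base P) X A)\<^esub>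
             reindex P (Prod (base P) X A) X (Pr1 (base P) X A) \<phi>}\<rparr>),
      reindex = (\<lambda>A B g.
        reindex P (Prod (base P) X A) (Prod (base P) X B)
          (pairing (base P) (Prod (base P) X A) X B (Pr1 (base P) X A) g))\<rparr>"

definition kleisli_map ::
    "('o, 'm, 'p) doctrine \<Rightarrow> 'o \<Rightarrow> 'p \<Rightarrow> ('o, 'm, 'p, 'o, 'm, 'p) doctrine_map" where
  "kleisli_map P X \<phi> =
     \<lparr>fobj = (\<lambda>A. A),
      farr = (\<lambda>A B f. Comp (base P) (Prod (base P) X A) A B f (Pr2 (base P) X A)),
      trans = (\<lambda>A \<alpha>.
        reindex P (Prod (base P) X A) X (Pr1 (base P) X A) \<phi>
          \<sqinter>\<^bsub>fib P (Prod (base P) X A)\<^esub>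
        reindex P (Prod (base P) X A) A (Pr2 (base P) X A) \<alpha>)\<rparr>"

end

theory Submission
  imports Defs
begin

text \<open>
  Up to the associator \<open>a : (X \<times> C) \<times> B \<cong> X \<times> (C \<times> B)\<close>, reindexing along the Kleisli projection
  \<open>C \<times> B \<leadsto> C\<close> is reindexing along \<open>pr\<^sub>1 : (X \<times> C) \<times> B \<rightarrow> X \<times> C\<close>. Restricted to elements below \<open>\<phi>\<close>,
  its right adjoint is therefore \<open>\<alpha> \<mapsto> \<phi> \<and> \<forall>\<^sup>B P(a)(\<alpha>)\<close>, with \<open>\<forall>\<^sup>B\<close> taken over \<open>X \<times> C\<close> and \<open>\<phi>\<close>
  pulled back to \<open>X \<times> C\<close>. Beck--Chevalley follows from naturality of \<open>a\<close>, and Frobenius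
  reciprocity is transported along \<open>a\<close>. For the canonical homomorphism one uses in addition that
  \<open>\<gamma> \<and> \<forall>\<^sup>B(P(pr\<^sub>1)(\<gamma>) \<and> \<beta>) = \<gamma> \<and> \<forall>\<^sup>B \<beta>\<close>.
\<close>

section \<open>Categories with finite products\<close>

lemma is_product_induced:
  assumes "is_product C A B Q p q" "T \<in> Obj C" "f \<in> Hom C T A" "g \<in> Hom C T B"
  shows "induced C A B Q p q T f g \<in> Hom C T Q"
    and "Comp C T Q A p (induced C A B Q p q T f g) = f"
    and "Comp C T Q B q (induced C A B Q p q T f g) = g"
proof -
  have "\<exists>!h. h \<in> Hom C T Q \<and> Comp C T Q A p h = f \<and> Comp C T Q B q h = g"
    using assms unfolding is_product_def by blast
  from theI'[OF this] show "induced C A B Q p q T f g \<in> Hom C T Q"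
    and "Comp C T Q A p (induced C A B Q p q T f g) = f"
    and "Comp C T Q B q (induced C A B Q p q T f g) = g"
    unfolding induced_def by blast+
qed

lemma is_product_induced_eqI:
  assumes "is_product C A B Q p q" "T \<in> Obj C" "h \<in> Hom C T Q"
    and "Comp C T Q A p h = f" "Comp C T Q B q h = g"
    and "f \<in> Hom C T A" "g \<in> Hom C T B"
  shows "induced C A B Q p q T f g = h"
proof -
  have "\<exists>!h. h \<in> Hom C T Q \<and> Comp C T Q A p h = f \<and> Comp C T Q B q h = g"
    using assms unfolding is_product_def by blast
  then show ?thesis
    unfolding induced_def using assms by (intro the1_equality) auto
qed

context finite_product_category
begin

text \<open>Composites are bracketed to the right. Together with \<open>pairing_Comp\<close>, which
  moves a composite inside a pairing, this normalises arrows built from projections and pairings, so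
  most later arrow equations follow by simplification.\<close>

declare Id_closed [simp] Comp_closed [simp] Comp_Id_left [simp] Comp_Id_right [simp]
  Comp_assoc [symmetric, simp]

lemma
  assumes "A \<in> Obj C" "B \<in> Obj C"
  shows Prod_closed [simp]: "Prod C A B \<in> Obj C"
    and Pr1_closed [simp]: "Pr1 C A B \<in> Hom C (Prod C A B) A"
    and Pr2_closed [simp]: "Pr2 C A B \<in> Hom C (Prod C A B) B"
  using Prod_product[OF assms] unfolding is_product_def by auto

lemma
  assumes "A \<in> Obj C" "B \<in> Obj C" "T \<in> Obj C" "f \<in> Hom C T A" "g \<in> Hom C T B"
  shows pairing_closed [simp]: "pairing C T A B f g \<in> Hom C T (Prod C A B)"
    and Pr1_pairing [simp]: "Comp C T (Prod C A B) A (Pr1 C A B) (pairing C T A B f g) = f"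
    and Pr2_pairing [simp]: "Comp C T (Prod C A B) B (Pr2 C A B) (pairing C T A B f g) = g"
  using is_product_induced[OF Prod_product[OF assms(1,2)] assms(3-5)]
  unfolding pairing_def by auto

lemma pairing_eqI:
  assumes "A \<in> Obj C" "B \<in> Obj C" "T \<in> Obj C" "h \<in> Hom C T (Prod C A B)"
    and "Comp C T (Prod C A B) A (Pr1 C A B) h = f" "Comp C T (Prod C A B) B (Pr2 C A B) h = g"
  shows "pairing C T A B f g = h"
  unfolding pairing_def using assms
  by (intro is_product_induced_eqI[OF Prod_product]) auto

lemma pairing_surjective [simp]:
  assumes "A \<in> Obj C" "B \<in> Obj C" "T \<in> Obj C" "h \<in> Hom C T (Prod C A B)"
  shows "pairing C T A B (Comp C T (Prod C A B) A (Pr1 C A B) h)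
      (Comp C T (Prod C A B) B (Pr2 C A B) h) = h"
  using assms by (intro pairing_eqI) auto

lemma pairing_Pr [simp]:
  assumes "A \<in> Obj C" "B \<in> Obj C"
  shows "pairing C (Prod C A B) A B (Pr1 C A B) (Pr2 C A B) = Id C (Prod C A B)"
  using assms by (intro pairing_eqI) auto

lemma pairing_Comp [simp]:
  assumes "A \<in> Obj C" "B \<in> Obj C" "T \<in> Obj C" "T' \<in> Obj C"
    and "f \<in> Hom C T A" "g \<in> Hom C T B" "k \<in> Hom C T' T"
  shows "Comp C T' T (Prod C A B) (pairing C T A B f g) k
      = pairing C T' A B (Comp C T' T A f k) (Comp C T' T B g k)"
proof (rule pairing_eqI[symmetric])
  show "Comp C T' (Prod C A B) A (Pr1 C A B) (Comp C T' T (Prod C A B) (pairing C T A B f g) k)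
      = Comp C T' T A f k"
    \<comment> \<open>The bracketing opposite to the simplifier's lets the projection meet the
      pairing directly.\<close>
    using assms by (subst Comp_assoc) auto
  show "Comp C T' (Prod C A B) B (Pr2 C A B) (Comp C T' T (Prod C A B) (pairing C T A B f g) k)
      = Comp C T' T B g k"
    using assms by (subst Comp_assoc) auto
qed (use assms in auto)

end


section \<open>The Kleisli category\<close>

lemma kleisli_cat_sel [simp]:
  "Obj (kleisli_cat C X) = Obj C"
  "Hom (kleisli_cat C X) A B = Hom C (Prod C X A) B"
  "Id (kleisli_cat C X) A = Pr2 C X A"
  "Comp (kleisli_cat C X) A B E h g =
    Comp C (Prod C X A) (Prod C X B) E h (pairing C (Prod C X A) X B (Pr1 C X A) g)"
  "One (kleisli_cat C X) = One C"
  "Prod (kleisli_cat C X) = Prod C"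
  "Pr1 (kleisli_cat C X) A B = Comp C (Prod C X (Prod C A B)) (Prod C A B) A
     (Pr1 C A B) (Pr2 C X (Prod C A B))"
  "Pr2 (kleisli_cat C X) A B = Comp C (Prod C X (Prod C A B)) (Prod C A B) B
     (Pr2 C A B) (Pr2 C X (Prod C A B))"
  unfolding kleisli_cat_def by simp_all

locale kleisli_category = finite_product_category C for C :: "('o, 'm) fpcat" +
  fixes X :: 'o
  assumes X_Obj [simp]: "X \<in> Obj C"
begin

lemma is_functor_kleisli:
  "is_functor C (kleisli_cat C X) (\<lambda>A. A)
    (\<lambda>A B f. Comp C (Prod C X A) A B f (Pr2 C X A))"
  unfolding is_functor_def by simp

text \<open>Composing a Kleisli arrow from \<open>T\<close> to \<open>Q\<close> with
  \<open>p pr2\<close> is composing it with \<open>p\<close> in \<open>C\<close>, so the universal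
  property at \<open>T\<close> is that of \<open>C\<close> at \<open>X x T\<close>. Treating
  arbitrary cones yields both the chosen products and their preservation.\<close>

lemma is_product_kleisli:
  assumes "is_product C A B Q p q"
  shows "is_product (kleisli_cat C X) A B Q
    (Comp C (Prod C X Q) Q A p (Pr2 C X Q)) (Comp C (Prod C X Q) Q B q (Pr2 C X Q))"
proof -
  have [simp]: "A \<in> Obj C" "B \<in> Obj C" "Q \<in> Obj C" "p \<in> Hom C Q A" "q \<in> Hom C Q B"
    using assms unfolding is_product_def by auto
  have "\<exists>!h. h \<in> Hom C (Prod C X T) Q \<and> Comp C (Prod C X T) Q A p h = f
      \<and> Comp C (Prod C X T) Q B q h = g"
    if "T \<in> Obj C" "f \<in> Hom C (Prod C X T) A" "g \<in> Hom C (Prod C X T) B" for T f g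
    using assms that unfolding is_product_def by simp
  then show ?thesis
    unfolding is_product_def by (simp cong: conj_cong)
qed

lemma is_terminal_kleisli: "is_terminal C T \<Longrightarrow> is_terminal (kleisli_cat C X) T"
  unfolding is_terminal_def by simp

lemma finite_product_category_kleisli: "finite_product_category (kleisli_cat C X)"
proof (unfold_locales, goal_cases)
  case 7
  then show ?case using is_product_kleisli[OF Prod_product] by simp
qed (simp_all add: is_terminal_kleisli One_terminal)

lemma pairing_kleisli:
  assumes "T \<in> Obj C" "A \<in> Obj C" "B \<in> Obj C"
    and "f \<in> Hom C (Prod C X T) A" "g \<in> Hom C (Prod C X T) B"
  shows "pairing (kleisli_cat C X) T A B f g = pairing C (Prod C X T) A B f g"
  using assms
  by (intro finite_product_category.pairing_eqI[OF finite_product_category_kleisli]) simp_all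

text \<open>The functor preserves the chosen products strictly: the right-hand side is the Kleisli
  identity.\<close>

lemma prod_comparison_kleisli:
  assumes "A \<in> Obj C" "B \<in> Obj C"
  shows "prod_comparison C (kleisli_cat C X) (\<lambda>A. A)
     (\<lambda>A B f. Comp C (Prod C X A) A B f (Pr2 C X A)) A B = Pr2 C X (Prod C A B)"
  using assms unfolding prod_comparison_def
  by (intro is_product_induced_eqI is_product_kleisli Prod_product) auto

text \<open>
  \<open>lift A B g = \<langle>pr\<^sub>1, g\<rangle>\<close> is the arrow of \<open>C\<close> along which the Kleisli arrow \<open>g : A \<leadsto> B\<close> reindexes.
\<close>

abbreviation lift :: "'o \<Rightarrow> 'o \<Rightarrow> 'm \<Rightarrow> 'm" where
  "lift A B g \<equiv> pairing C (Prod C X A) X B (Pr1 C X A) g"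

section \<open>The associator between \<open>(X x A) x B\<close> and
  \<open>X x (A x B)\<close>\<close>

definition assoc :: "'o \<Rightarrow> 'o \<Rightarrow> 'm" where
  "assoc A B =
    (let Q = Prod C (Prod C X A) B; p = Pr1 C (Prod C X A) B in
      pairing C Q X (Prod C A B) (Comp C Q (Prod C X A) X (Pr1 C X A) p)
        (pairing C Q A B (Comp C Q (Prod C X A) A (Pr2 C X A) p) (Pr2 C (Prod C X A) B)))"

text \<open>Written with the Kleisli projections, so that its first component is the very arrow
  along which the Kleisli projection reindexes.\<close>

definition assoc_inv :: "'o \<Rightarrow> 'o \<Rightarrow> 'm" where
  "assoc_inv A B =
    (let Q = Prod C X (Prod C A B) in
      pairing C Q (Prod C X A) B (lift (Prod C A B) A (Pr1 (kleisli_cat C X) A B))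
        (Pr2 (kleisli_cat C X) A B))"

lemma assoc_closed [simp]:
  assumes "A \<in> Obj C" "B \<in> Obj C"
  shows "assoc A B \<in> Hom C (Prod C (Prod C X A) B) (Prod C X (Prod C A B))"
    and "assoc_inv A B \<in> Hom C (Prod C X (Prod C A B)) (Prod C (Prod C X A) B)"
  using assms by (simp_all add: Let_def assoc_def assoc_inv_def)

text \<open>All composites reduce to tuples of projections. \<open>Pr1_assoc_inv\<close> factors
  Kleisli reindexing along a projection through \<open>pr1\<close> of \<open>(X x A) x B\<close>;
  \<open>Pr1_assoc\<close> and \<open>Pr2_assoc\<close> tell what the associator does to the two
  conjuncts of the canonical 1-arrow.\<close>

lemma
  assumes "A \<in> Obj C" "B \<in> Obj C"
  shows assoc_assoc_inv: "Comp C (Prod C X (Prod C A B)) (Prod C (Prod C X A) B)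
      (Prod C X (Prod C A B)) (assoc A B) (assoc_inv A B) = Id C (Prod C X (Prod C A B))"
    and assoc_inv_assoc: "Comp C (Prod C (Prod C X A) B) (Prod C X (Prod C A B))
      (Prod C (Prod C X A) B) (assoc_inv A B) (assoc A B) = Id C (Prod C (Prod C X A) B)"
    and Pr1_assoc_inv: "Comp C (Prod C X (Prod C A B)) (Prod C (Prod C X A) B) (Prod C X A)
      (Pr1 C (Prod C X A) B) (assoc_inv A B) = lift (Prod C A B) A (Pr1 (kleisli_cat C X) A B)"
    and Pr1_assoc: "Comp C (Prod C (Prod C X A) B) (Prod C X (Prod C A B)) X
      (Pr1 C X (Prod C A B)) (assoc A B)
      = Comp C (Prod C (Prod C X A) B) (Prod C X A) X (Pr1 C X A) (Pr1 C (Prod C X A) B)"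
    and Pr2_assoc: "Comp C (Prod C (Prod C X A) B) (Prod C X (Prod C A B)) (Prod C A B)
      (Pr2 C X (Prod C A B)) (assoc A B)
      = prod_map C (Prod C X A) A B B (Pr2 C X A) (Id C B)"
  using assms by (simp_all add: Let_def assoc_def assoc_inv_def prod_map_def)

lemma prod_map_closed [simp]:
  assumes "A \<in> Obj C" "A' \<in> Obj C" "B \<in> Obj C" "B' \<in> Obj C" "f \<in> Hom C A A'" "g \<in> Hom C B B'"
  shows "prod_map C A A' B B' f g \<in> Hom C (Prod C A B) (Prod C A' B')"
  using assms by (simp add: prod_map_def)

lemma prod_map_kleisli_closed [simp]:
  assumes "A \<in> Obj C" "A' \<in> Obj C" "B \<in> Obj C" "f \<in> Hom C (Prod C X A) A'"
  shows "prod_map (kleisli_cat C X) A A' B B f (Pr2 C X B)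
    \<in> Hom C (Prod C X (Prod C A B)) (Prod C A' B)"
  using assms by (simp add: prod_map_def pairing_kleisli)

text \<open>Both sides have components \<open>pr1 pr1\<close>, \<open>f pr1\<close> and
  \<open>pr2\<close>. Since \<open>Pr2 C X B\<close> is the Kleisli identity of \<open>B\<close>,
  the right-hand side contains the lift of the Kleisli arrow \<open>f x id\<close>.\<close>

lemma assoc_natural:
  assumes "A \<in> Obj C" "A' \<in> Obj C" "B \<in> Obj C" "f \<in> Hom C (Prod C X A) A'"
  shows "Comp C (Prod C (Prod C X A) B) (Prod C (Prod C X A') B) (Prod C X (Prod C A' B))
      (assoc A' B) (prod_map C (Prod C X A) (Prod C X A') B B (lift A A' f) (Id C B))
    = Comp C (Prod C (Prod C X A) B) (Prod C X (Prod C A B)) (Prod C X (Prod C A' B))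
      (lift (Prod C A B) (Prod C A' B) (prod_map (kleisli_cat C X) A A' B B f (Pr2 C X B)))
      (assoc A B)"
  using assms by (simp add: Let_def assoc_def prod_map_def pairing_kleisli)

end


section \<open>Principal down-sets\<close>

text \<open>Order-theoretic Yoneda: test at \<open>z = x\<close> and \<open>z = y\<close>. It
  reduces equations between meets and right adjoints to comparisons of lower bounds.\<close>

lemma (in partial_order) eq_if_same_lower_bounds:
  assumes "x \<in> carrier L" "y \<in> carrier L"
    and "\<And>z. z \<in> carrier L \<Longrightarrow> z \<sqsubseteq> x \<longleftrightarrow> z \<sqsubseteq> y"
  shows "x = y"
  using assms by (meson le_antisym le_refl)

context lower_semilattice
begin

lemma le_meet_iff:
  assumes "x \<in> carrier L" "y \<in> carrier L" "z \<in> carrier L"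
  shows "z \<sqsubseteq> x \<sqinter> y \<longleftrightarrow> z \<sqsubseteq> x \<and> z \<sqsubseteq> y"
proof
  show "z \<sqsubseteq> x \<sqinter> y \<Longrightarrow> z \<sqsubseteq> x \<and> z \<sqsubseteq> y"
    using assms meet_left[of x y] meet_right[of x y]
      le_trans[of z "x \<sqinter> y" x] le_trans[of z "x \<sqinter> y" y] by simp
qed (use assms in \<open>auto intro: meet_le\<close>)

text \<open>With \<open>d\<close> the pullback of \<phi>, these are the fibres of the Kleisli
  doctrine. The order is inherited, whereas meets and top are chosen by bounds within the carrier
  and have to be identified anew.\<close>

abbreviation down :: "'a \<Rightarrow> ('a, 'b) gorder_scheme" where
  "down d \<equiv> L\<lparr>carrier := {x \<in> carrier L. x \<sqsubseteq> d}\<rparr>"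

lemma partial_order_down: "partial_order (down d)"
proof (rule partial_order.intro)
  show "weak_partial_order (down d)"
    using weak_partial_order_axioms by (rule weak_partial_order_subset) auto
qed (simp add: partial_order_axioms_def eq_is_equal)

text \<open>The meet lies below \<open>x\<close>, hence below \<open>d\<close>, and remains greatest
  among the lower bounds that are left.\<close>

lemma is_glb_down:
  assumes "d \<in> carrier L" "x \<in> carrier L" "y \<in> carrier L" "x \<sqsubseteq> d" "y \<sqsubseteq> d"
  shows "is_glb (down d) (x \<sqinter> y) {x, y}"
  using assms meet_left[of x y] meet_right[of x y] le_trans[of "x \<sqinter> y" x d]
  by (intro greatest_LowerI) (auto simp: Lower_def intro!: meet_le)

lemma lower_semilattice_down:
  assumes "d \<in> carrier L"
  shows "lower_semilattice (down d)"
proof (intro lower_semilattice.intro lower_semilattice_axioms.intro partial_order_down)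
  show "\<exists>s. is_glb (down d) s {x, y}" if "x \<in> carrier (down d)" "y \<in> carrier (down d)" for x y
    using is_glb_down[of d x y] assms that by auto
qed

lemma meet_down:
  assumes "d \<in> carrier L" "x \<in> carrier L" "y \<in> carrier L" "x \<sqsubseteq> d" "y \<sqsubseteq> d"
  shows "x \<sqinter>\<^bsub>down d\<^esub> y = x \<sqinter> y"
proof -
  interpret D: lower_semilattice "down d"
    using assms(1) by (rule lower_semilattice_down)
  show ?thesis
  proof (rule D.meetI)
    show "i = x \<sqinter> y" if "is_glb (down d) i {x, y}" for i
      using that is_glb_down[OF assms] by (rule D.greatest_unique)
  qed (use assms in auto)
qed

lemma
  assumes "d \<in> carrier L"
  shows weak_partial_order_top_down: "weak_partial_order_top (down d)"
    and top_down: "\<top>\<^bsub>down d\<^esub> = d"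
proof -
  have g: "greatest (down d) d (carrier (down d))"
    using assms by (auto simp: greatest_def)
  then show "weak_partial_order_top (down d)"
    using partial_order.axioms(1)[OF partial_order_down]
    by (auto simp: weak_partial_order_top_def weak_partial_order_top_axioms_def)
  show "\<top>\<^bsub>down d\<^esub> = d"
    unfolding top_def using g partial_order.greatest_unique[OF partial_order_down]
    by (intro some_equality) auto
qed

end


section \<open>Doctrines and their universal quantifiers\<close>

context doctrine
begin

lemma reindex_mem [simp]:
  assumes "A \<in> Obj (base P)" "B \<in> Obj (base P)" "f \<in> Hom (base P) A B" "\<alpha> \<in> carrier (fib P B)"
  shows "reindex P A B f \<alpha> \<in> carrier (fib P A)"
  using reindex_closed assms by blast

lemma reindex_le:
  assumes "A \<in> Obj (base P)" "B \<in> Obj (base P)" "f \<in> Hom (base P) A B"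
    and "\<alpha> \<in> carrier (fib P B)" "\<beta> \<in> carrier (fib P B)" "\<alpha> \<sqsubseteq>\<^bsub>fib P B\<^esub> \<beta>"
  shows "reindex P A B f \<alpha> \<sqsubseteq>\<^bsub>fib P A\<^esub> reindex P A B f \<beta>"
  using reindex_mono[OF assms(1-3)] assms(4-) by (auto simp: isotone_def)

text \<open>By functoriality, reindexing along \<open>f\<close> and along \<open>g\<close> are
  mutually inverse monotone maps: apply one and cancel.\<close>

lemma reindex_iso_le_iff:
  assumes "A \<in> Obj (base P)" "B \<in> Obj (base P)" "f \<in> Hom (base P) A B" "g \<in> Hom (base P) B A"
    and "Comp (base P) A B A g f = Id (base P) A" "Comp (base P) B A B f g = Id (base P) B"
    and "\<alpha> \<in> carrier (fib P A)" "\<beta> \<in> carrier (fib P B)"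
  shows "reindex P B A g \<alpha> \<sqsubseteq>\<^bsub>fib P B\<^esub> \<beta> \<longleftrightarrow> \<alpha> \<sqsubseteq>\<^bsub>fib P A\<^esub> reindex P A B f \<beta>"
proof
  have "reindex P A B f (reindex P B A g \<alpha>) = \<alpha>"
    using assms by (simp flip: reindex_Comp add: reindex_Id)
  then show "\<alpha> \<sqsubseteq>\<^bsub>fib P A\<^esub> reindex P A B f \<beta>" if "reindex P B A g \<alpha> \<sqsubseteq>\<^bsub>fib P B\<^esub> \<beta>"
    using reindex_le[OF assms(1-3) _ _ that] assms by simp
  have "reindex P B A g (reindex P A B f \<beta>) = \<beta>"
    using assms by (simp flip: reindex_Comp add: reindex_Id)
  then show "reindex P B A g \<alpha> \<sqsubseteq>\<^bsub>fib P B\<^esub> \<beta>" if "\<alpha> \<sqsubseteq>\<^bsub>fib P A\<^esub> reindex P A B f \<beta>"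
    using reindex_le[OF assms(2,1,4) _ _ that] assms by simp
qed

end

lemma forall_adjoint_iff:
  "forall_adjoint P B C u \<longleftrightarrow>
    partial_order (fib P C) \<and> partial_order (fib P (Prod (base P) C B)) \<and>
    reindex P (Prod (base P) C B) C (Pr1 (base P) C B)
      \<in> carrier (fib P C) \<rightarrow> carrier (fib P (Prod (base P) C B)) \<and>
    u \<in> carrier (fib P (Prod (base P) C B)) \<rightarrow> carrier (fib P C) \<and>
    (\<forall>\<gamma> \<in> carrier (fib P C). \<forall>\<beta> \<in> carrier (fib P (Prod (base P) C B)).
      reindex P (Prod (base P) C B) C (Pr1 (base P) C B) \<gamma> \<sqsubseteq>\<^bsub>fib P (Prod (base P) C B)\<^esub> \<beta>
        \<longleftrightarrow> \<gamma> \<sqsubseteq>\<^bsub>fib P C\<^esub> u \<beta>)"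
  by (auto simp: forall_adjoint_def galois_connection_def galois_connection_axioms_def
      connection_def)

lemma forall_adjoint_unique:
  assumes "forall_adjoint P B C u" "forall_adjoint P B C v"
    and "\<beta> \<in> carrier (fib P (Prod (base P) C B))"
  shows "u \<beta> = v \<beta>"
proof -
  interpret partial_order "fib P C"
    using assms by (simp add: forall_adjoint_iff)
  have "u \<beta> \<in> carrier (fib P C)" "v \<beta> \<in> carrier (fib P C)"
    using assms by (auto simp: forall_adjoint_iff)
  \<comment> \<open>Each inequality starts from reflexivity, say of \<open>u \<beta>\<close>: one
    adjunction transposes to the fibre over the product, the other transposes back.\<close>
  moreover from this have "u \<beta> \<sqsubseteq>\<^bsub>fib P C\<^esub> v \<beta>" "v \<beta> \<sqsubseteq>\<^bsub>fib P C\<^esub> u \<beta>"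
    using assms unfolding forall_adjoint_iff by (metis le_refl)+
  ultimately show ?thesis by (intro le_antisym)
qed

lemma forall_adjoint_forallq: "forall_adjoint P B C u \<Longrightarrow> forall_adjoint P B C (forallq P B C)"
  unfolding forallq_def by (rule someI[of "forall_adjoint P B C"])

lemma
  assumes "universal_doctrine P" "B \<in> Obj (base P)" "C \<in> Obj (base P)"
    and "\<beta> \<in> carrier (fib P (Prod (base P) C B))"
  shows forallq_closed: "forallq P B C \<beta> \<in> carrier (fib P C)"
    and le_forallq_iff: "\<gamma> \<in> carrier (fib P C) \<Longrightarrow>
      \<gamma> \<sqsubseteq>\<^bsub>fib P C\<^esub> forallq P B C \<beta> \<longleftrightarrow>
      reindex P (Prod (base P) C B) C (Pr1 (base P) C B) \<gamma> \<sqsubseteq>\<^bsub>fib P (Prod (base P) C B)\<^esub> \<beta>"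
proof -
  have "\<forall>B \<in> Obj (base P). \<forall>C \<in> Obj (base P). \<exists>u. forall_adjoint P B C u"
    using assms(1) unfolding universal_doctrine_def by (elim conjE)
  then obtain u where "forall_adjoint P B C u"
    using assms(2,3) by blast
  then have "forall_adjoint P B C (forallq P B C)"
    by (rule forall_adjoint_forallq)
  then show "forallq P B C \<beta> \<in> carrier (fib P C)"
    and "\<gamma> \<in> carrier (fib P C) \<Longrightarrow>
      \<gamma> \<sqsubseteq>\<^bsub>fib P C\<^esub> forallq P B C \<beta> \<longleftrightarrow>
      reindex P (Prod (base P) C B) C (Pr1 (base P) C B) \<gamma> \<sqsubseteq>\<^bsub>fib P (Prod (base P) C B)\<^esub> \<beta>"
    using assms(4) unfolding forall_adjoint_iff by auto
qed


section \<open>The Kleisli doctrine\<close>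

locale kleisli_doctrine = primary_doctrine P
  for P :: "('o, 'm, 'p) doctrine" +
  fixes X :: 'o and \<phi> :: 'p
  assumes X_Obj: "X \<in> Obj (base P)"
    and \<phi>_closed [simp]: "\<phi> \<in> carrier (fib P X)"

sublocale kleisli_doctrine \<subseteq> kleisli_category "base P" X
  using base_fp X_Obj by (simp add: kleisli_category_def kleisli_category_axioms_def)

context kleisli_doctrine
begin

declare reindex_Id [simp] reindex_Comp [symmetric, simp] reindex_meet [simp]

abbreviation \<phi>_at :: "'o \<Rightarrow> 'p" where
  "\<phi>_at A \<equiv> reindex P (Prod (base P) X A) X (Pr1 (base P) X A) \<phi>"

lemma kleisli_sel [simp]:
  "base (kleisli P X \<phi>) = kleisli_cat (base P) X"
  "fib (kleisli P X \<phi>) A = lower_semilattice.down (fib P (Prod (base P) X A)) (\<phi>_at A)"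
  "reindex (kleisli P X \<phi>) A B g
    = reindex P (Prod (base P) X A) (Prod (base P) X B) (lift A B g)"
  by (simp_all add: kleisli_def)

text \<open>The lift followed by \<open>pr1\<close> is \<open>pr1\<close>, so reindexing along it
  sends \<open>\<phi>_at B\<close> to \<open>\<phi>_at A\<close>. Hence Kleisli reindexing restricts
  to the fibres.\<close>

lemma reindex_lift_le:
  assumes "A \<in> Obj (base P)" "B \<in> Obj (base P)" "g \<in> Hom (base P) (Prod (base P) X A) B"
    and "\<alpha> \<in> carrier (fib P (Prod (base P) X B))" "\<alpha> \<sqsubseteq>\<^bsub>fib P (Prod (base P) X B)\<^esub> \<phi>_at B"
  shows "reindex P (Prod (base P) X A) (Prod (base P) X B) (lift A B g) \<alpha>
    \<sqsubseteq>\<^bsub>fib P (Prod (base P) X A)\<^esub> \<phi>_at A"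
  using reindex_le[OF _ _ _ assms(4) _ assms(5), of "Prod (base P) X A" "lift A B g"] assms
  by simp

lemma doctrine_kleisli: "doctrine (kleisli P X \<phi>)"
proof (intro doctrine.intro, goal_cases)
  case 1
  then show ?case using finite_product_category_kleisli by simp
next
  case (2 A)
  then show ?case by (simp add: fib_meet lower_semilattice.partial_order_down)
next
  case (3 A B f)
  then show ?case by (auto simp: reindex_lift_le)
next
  case (4 A B f)
  then show ?case
    by (auto simp: isotone_def fib_meet lower_semilattice.partial_order_down
        partial_order.axioms(1) intro: reindex_le)
\<comment> \<open>Functoriality remains: the lift of a Kleisli identity is an identity, and the lift
  of a Kleisli composite is the composite of the lifts.\<close>
qed simp_all

lemma primary_doctrine_kleisli: "primary_doctrine (kleisli P X \<phi>)"
proof (intro primary_doctrine.intro primary_doctrine_axioms.intro doctrine_kleisli, goal_cases)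
  case (1 A)
  then show ?case by (simp add: fib_meet lower_semilattice.lower_semilattice_down)
next
  case (2 A)
  then show ?case by (simp add: fib_meet lower_semilattice.weak_partial_order_top_down)
next
  case (3 A B f \<alpha> \<beta>)
  then show ?case by (simp add: fib_meet lower_semilattice.meet_down reindex_lift_le)
next
  case (4 A B f)
  \<comment> \<open>The top of each fibre is the pullback of \<phi>, which lifts respect.\<close>
  then show ?case by (simp add: fib_meet lower_semilattice.top_down)
qed

section \<open>The canonical 1-arrow\<close>

lemma kleisli_map_sel [simp]:
  "fobj (kleisli_map P X \<phi>) = (\<lambda>A. A)"
  "farr (kleisli_map P X \<phi>)
    = (\<lambda>A B f. Comp (base P) (Prod (base P) X A) A B f (Pr2 (base P) X A))"
  "trans (kleisli_map P X \<phi>) A \<alpha> = \<phi>_at A \<sqinter>\<^bsub>fib P (Prod (base P) X A)\<^esub>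
    reindex P (Prod (base P) X A) A (Pr2 (base P) X A) \<alpha>"
  by (simp_all add: kleisli_map_def)

lemma kleisli_map_mem:
  assumes "A \<in> Obj (base P)" "\<alpha> \<in> carrier (fib P A)"
  shows "trans (kleisli_map P X \<phi>) A \<alpha> \<in> carrier (fib P (Prod (base P) X A))"
    and "trans (kleisli_map P X \<phi>) A \<alpha> \<sqsubseteq>\<^bsub>fib P (Prod (base P) X A)\<^esub> \<phi>_at A"
proof -
  interpret lower_semilattice "fib P (Prod (base P) X A)"
    using assms by (simp add: fib_meet)
  show "trans (kleisli_map P X \<phi>) A \<alpha> \<in> carrier (fib P (Prod (base P) X A))"
    and "trans (kleisli_map P X \<phi>) A \<alpha> \<sqsubseteq>\<^bsub>fib P (Prod (base P) X A)\<^esub> \<phi>_at A"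
    using assms by (simp_all add: meet_left)
qed

lemma kleisli_map_mono:
  assumes "A \<in> Obj (base P)" "\<alpha> \<in> carrier (fib P A)" "\<beta> \<in> carrier (fib P A)"
    and "\<alpha> \<sqsubseteq>\<^bsub>fib P A\<^esub> \<beta>"
  shows "trans (kleisli_map P X \<phi>) A \<alpha> \<sqsubseteq>\<^bsub>fib P (Prod (base P) X A)\<^esub>
    trans (kleisli_map P X \<phi>) A \<beta>"
proof -
  interpret lower_semilattice "fib P (Prod (base P) X A)"
    using assms by (simp add: fib_meet)
  have "reindex P (Prod (base P) X A) A (Pr2 (base P) X A) \<alpha> \<sqsubseteq>\<^bsub>fib P (Prod (base P) X A)\<^esub>
      reindex P (Prod (base P) X A) A (Pr2 (base P) X A) \<beta>"
    using assms by (intro reindex_le) simp_all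
  with assms show ?thesis
    using le_trans[OF meet_right] by (simp add: le_meet_iff meet_left)
qed

lemma doctrine_hom_kleisli: "doctrine_hom P (kleisli P X \<phi>) (kleisli_map P X \<phi>)"
  unfolding doctrine_hom_def
proof (intro conjI ballI, goal_cases)
  case 1
  then show ?case by (rule doctrine_axioms)
next
  case 2
  then show ?case by (rule doctrine_kleisli)
next
  case 3
  then show ?case using is_functor_kleisli by simp
next
  case 4
  then show ?case
    using is_product_kleisli is_terminal_kleisli by (simp add: preserves_finite_products_def)
next
  case (5 A)
  then show ?case using kleisli_map_mem by auto
next
  case (6 A)
  then have "weak_partial_order (fib (kleisli P X \<phi>) A)"
    using doctrine.fib_poset[OF doctrine_kleisli, of A] partial_order.axioms(1) by auto
  then show ?case
    using 6 kleisli_map_mono partial_order.axioms(1)[OF fib_poset[of A]]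
    by (auto simp: isotone_def)
next
  case (7 A B f \<beta>)
  \<comment> \<open>Naturality: the lift of \<open>f pr2\<close> followed by \<open>pr1\<close> is
    \<open>pr1\<close>, followed by \<open>pr2\<close> it is \<open>f pr2\<close>, and reindexing
    preserves the meet.\<close>
  then show ?case by simp
qed

end


section \<open>Quantifiers of the Kleisli doctrine\<close>

locale kleisli_universal = kleisli_doctrine P X \<phi>
  for P :: "('o, 'm, 'p) doctrine" and X :: 'o and \<phi> :: 'p +
  assumes universal: "universal_doctrine P"
begin

lemma forallq_mem [simp]:
  assumes "B \<in> Obj (base P)" "A \<in> Obj (base P)" "\<beta> \<in> carrier (fib P (Prod (base P) A B))"
  shows "forallq P B A \<beta> \<in> carrier (fib P A)"
  using universal assms by (rule forallq_closed)

lemma beck_chevalley: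
  assumes "B \<in> Obj (base P)" "A \<in> Obj (base P)" "A' \<in> Obj (base P)" "f \<in> Hom (base P) A A'"
    and "\<beta> \<in> carrier (fib P (Prod (base P) A' B))"
  shows "reindex P A A' f (forallq P B A' \<beta>) = forallq P B A
    (reindex P (Prod (base P) A B) (Prod (base P) A' B)
      (prod_map (base P) A A' B B f (Id (base P) B)) \<beta>)"
  using universal assms unfolding universal_doctrine_def by blast

text \<open>A lower bound \<delta> of either side lies below \<gamma>, so its reindexing along
  \<open>pr1\<close> lies below that of \<gamma>; after transposition the extra conjunct holds
  automatically.\<close>

lemma meet_forallq_reindex_meet:
  assumes "B \<in> Obj (base P)" "A \<in> Obj (base P)" "\<gamma> \<in> carrier (fib P A)"
    and "\<beta> \<in> carrier (fib P (Prod (base P) A B))"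
  shows "\<gamma> \<sqinter>\<^bsub>fib P A\<^esub> forallq P B A
      (reindex P (Prod (base P) A B) A (Pr1 (base P) A B) \<gamma> \<sqinter>\<^bsub>fib P (Prod (base P) A B)\<^esub> \<beta>)
    = \<gamma> \<sqinter>\<^bsub>fib P A\<^esub> forallq P B A \<beta>"
proof -
  let ?p = "reindex P (Prod (base P) A B) A (Pr1 (base P) A B)"
  let ?\<beta> = "?p \<gamma> \<sqinter>\<^bsub>fib P (Prod (base P) A B)\<^esub> \<beta>"
  interpret A: lower_semilattice "fib P A"
    using assms by (simp add: fib_meet)
  interpret AB: lower_semilattice "fib P (Prod (base P) A B)"
    using assms by (simp add: fib_meet)
  have mem: "?\<beta> \<in> carrier (fib P (Prod (base P) A B))"
    using assms by simp
  show ?thesis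
  proof (rule A.eq_if_same_lower_bounds)
    show "\<delta> \<sqsubseteq>\<^bsub>fib P A\<^esub> \<gamma> \<sqinter>\<^bsub>fib P A\<^esub> forallq P B A ?\<beta> \<longleftrightarrow>
        \<delta> \<sqsubseteq>\<^bsub>fib P A\<^esub> \<gamma> \<sqinter>\<^bsub>fib P A\<^esub> forallq P B A \<beta>"
      if "\<delta> \<in> carrier (fib P A)" for \<delta>
      using assms that mem reindex_le[of "Prod (base P) A B" A "Pr1 (base P) A B" \<delta> \<gamma>]
      by (auto simp: A.le_meet_iff AB.le_meet_iff le_forallq_iff[OF universal])
  qed (use assms mem in simp_all)
qed

section \<open>The right adjoint along Kleisli projections\<close>

definition kforall :: "'o \<Rightarrow> 'o \<Rightarrow> 'p \<Rightarrow> 'p" where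
  "kforall B A \<alpha> = \<phi>_at A \<sqinter>\<^bsub>fib P (Prod (base P) X A)\<^esub>
     forallq P B (Prod (base P) X A)
       (reindex P (Prod (base P) (Prod (base P) X A) B) (Prod (base P) X (Prod (base P) A B))
         (assoc A B) \<alpha>)"

text \<open>Factor the Kleisli projection through \<open>assoc_inv\<close>, move this isomorphism to
  the other side, transpose with the quantifier of \<open>P\<close> over \<open>X x A\<close>, and
  add the conjunct \<open>\<phi>_at A\<close>, which is above \<gamma> by assumption.\<close>

lemma le_kforall_iff:
  assumes "B \<in> Obj (base P)" "A \<in> Obj (base P)"
    and "\<gamma> \<in> carrier (fib P (Prod (base P) X A))" "\<gamma> \<sqsubseteq>\<^bsub>fib P (Prod (base P) X A)\<^esub> \<phi>_at A"
    and "\<beta> \<in> carrier (fib P (Prod (base P) X (Prod (base P) A B)))"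
  shows "reindex (kleisli P X \<phi>) (Prod (base P) A B) A (Pr1 (kleisli_cat (base P) X) A B) \<gamma>
      \<sqsubseteq>\<^bsub>fib P (Prod (base P) X (Prod (base P) A B))\<^esub> \<beta>
    \<longleftrightarrow> \<gamma> \<sqsubseteq>\<^bsub>fib P (Prod (base P) X A)\<^esub> kforall B A \<beta>"
proof -
  let ?XA = "Prod (base P) X A"
  let ?L = "Prod (base P) ?XA B" and ?R = "Prod (base P) X (Prod (base P) A B)"
  let ?\<beta> = "reindex P ?L ?R (assoc A B) \<beta>"
  interpret lower_semilattice "fib P ?XA"
    using assms by (simp add: fib_meet)
  have 1: "reindex (kleisli P X \<phi>) (Prod (base P) A B) A (Pr1 (kleisli_cat (base P) X) A B) \<gamma>
    = reindex P ?R ?L (assoc_inv A B) (reindex P ?L ?XA (Pr1 (base P) ?XA B) \<gamma>)"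
    using assms by (simp add: Pr1_assoc_inv)
  have 2: "reindex P ?R ?L (assoc_inv A B) (reindex P ?L ?XA (Pr1 (base P) ?XA B) \<gamma>)
      \<sqsubseteq>\<^bsub>fib P ?R\<^esub> \<beta>
    \<longleftrightarrow> reindex P ?L ?XA (Pr1 (base P) ?XA B) \<gamma> \<sqsubseteq>\<^bsub>fib P ?L\<^esub> ?\<beta>"
    using assms assoc_assoc_inv assoc_inv_assoc by (intro reindex_iso_le_iff) simp_all
  have 3: "reindex P ?L ?XA (Pr1 (base P) ?XA B) \<gamma> \<sqsubseteq>\<^bsub>fib P ?L\<^esub> ?\<beta>
    \<longleftrightarrow> \<gamma> \<sqsubseteq>\<^bsub>fib P ?XA\<^esub> forallq P B ?XA ?\<beta>"
    using assms universal by (intro le_forallq_iff[symmetric]) simp_all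
  have 4: "\<gamma> \<sqsubseteq>\<^bsub>fib P ?XA\<^esub> forallq P B ?XA ?\<beta> \<longleftrightarrow> \<gamma> \<sqsubseteq>\<^bsub>fib P ?XA\<^esub> kforall B A \<beta>"
    using assms by (simp add: kforall_def le_meet_iff)
  show ?thesis
    by (simp only: 1 2 3 4)
qed

lemma kforall_mem:
  assumes "B \<in> Obj (base P)" "A \<in> Obj (base P)"
    and "\<beta> \<in> carrier (fib P (Prod (base P) X (Prod (base P) A B)))"
  shows "kforall B A \<beta> \<in> carrier (fib P (Prod (base P) X A))"
    and "kforall B A \<beta> \<sqsubseteq>\<^bsub>fib P (Prod (base P) X A)\<^esub> \<phi>_at A"
proof -
  interpret lower_semilattice "fib P (Prod (base P) X A)"
    using assms by (simp add: fib_meet)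
  show "kforall B A \<beta> \<in> carrier (fib P (Prod (base P) X A))"
    and "kforall B A \<beta> \<sqsubseteq>\<^bsub>fib P (Prod (base P) X A)\<^esub> \<phi>_at A"
    using assms unfolding kforall_def by (simp_all add: meet_left)
qed

lemma forall_adjoint_kforall:
  assumes "B \<in> Obj (base P)" "A \<in> Obj (base P)"
  shows "forall_adjoint (kleisli P X \<phi>) B A (kforall B A)"
proof -
  interpret K: doctrine "kleisli P X \<phi>"
    by (rule doctrine_kleisli)
  show ?thesis
    unfolding forall_adjoint_iff
  proof (intro conjI ballI, goal_cases)
    case 1
    then show ?case using assms by (intro K.fib_poset) simp
  next
    case 2
    then show ?case using assms by (intro K.fib_poset) simp
  next
    case 3
    then show ?case using assms by (intro K.reindex_closed) simp_all
  next
    case 4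
    then show ?case using assms kforall_mem by simp
  next
    case (5 \<gamma> \<beta>)
    then show ?case using assms le_kforall_iff[of B A \<gamma> \<beta>] by simp
  qed
qed

text \<open>The chosen \<open>forallq\<close> is determined only on the Kleisli fibre; the bound on
  \<beta> places it there.\<close>

lemma forallq_kleisli:
  assumes "B \<in> Obj (base P)" "A \<in> Obj (base P)"
    and "\<beta> \<in> carrier (fib P (Prod (base P) X (Prod (base P) A B)))"
    and "\<beta> \<sqsubseteq>\<^bsub>fib P (Prod (base P) X (Prod (base P) A B))\<^esub> \<phi>_at (Prod (base P) A B)"
  shows "forallq (kleisli P X \<phi>) B A \<beta> = kforall B A \<beta>"
  using assms forall_adjoint_kforall[OF assms(1,2)]
  by (intro forall_adjoint_unique[OF forall_adjoint_forallq]) auto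

text \<open>The lift respects the conjunct built from \<phi>. On the other, Beck-Chevalley for
  \<open>P\<close> along the lift produces its product with the identity of \<open>B\<close>, which
  \<open>assoc_natural\<close> converts into the Kleisli product map.\<close>

lemma kforall_beck_chevalley:
  assumes "B \<in> Obj (base P)" "A \<in> Obj (base P)" "A' \<in> Obj (base P)"
    and "f \<in> Hom (base P) (Prod (base P) X A) A'"
    and "\<beta> \<in> carrier (fib P (Prod (base P) X (Prod (base P) A' B)))"
  shows "reindex P (Prod (base P) X A) (Prod (base P) X A') (lift A A' f) (kforall B A' \<beta>)
    = kforall B A (reindex P (Prod (base P) X (Prod (base P) A B))
        (Prod (base P) X (Prod (base P) A' B))
        (lift (Prod (base P) A B) (Prod (base P) A' B)
          (prod_map (kleisli_cat (base P) X) A A' B B f (Pr2 (base P) X B))) \<beta>)"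
  using assms unfolding kforall_def
  \<comment> \<open>Without distribution over pairings, composites keep the form in which
    \<open>assoc_natural\<close> states them.\<close>
  by (simp add: beck_chevalley assoc_natural del: pairing_Comp)

lemma universal_doctrine_kleisli: "universal_doctrine (kleisli P X \<phi>)"
  unfolding universal_doctrine_def
proof (intro conjI ballI, goal_cases)
  case 1
  then show ?case by (rule doctrine_kleisli)
next
  case (2 B A)
  then show ?case using forall_adjoint_kforall by auto
next
  case (3 B A A' f \<beta>)
  then show ?case
    by (simp add: forallq_kleisli kforall_beck_chevalley reindex_lift_le)
qed

lemma universal_hom_kleisli: "universal_hom P (kleisli P X \<phi>) (kleisli_map P X \<phi>)"
  unfolding universal_hom_def
proof (intro conjI ballI, goal_cases)
  case 1
  then show ?case by (rule universal)
next
  case 2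
  then show ?case by (rule universal_doctrine_kleisli)
next
  case 3
  then show ?case by (rule doctrine_hom_kleisli)
next
  case (4 B A \<beta>)
  let ?AB = "Prod (base P) A B"
  let ?\<beta> = "trans (kleisli_map P X \<phi>) ?AB \<beta>"
  \<comment> \<open>The associator turns the \<phi> conjunct of \<open>?\<beta>\<close> into the
    \<open>pr1\<close> pullback of \<open>\<phi>_at A\<close>, which is absorbed by the meet outside
    the quantifier. What remains is \<beta> reindexed along \<open>pr2 x id\<close>, and
    Beck-Chevalley along \<open>pr2\<close> applies.\<close>
  have "kforall B A ?\<beta> = trans (kleisli_map P X \<phi>) A (forallq P B A \<beta>)"
    using 4 meet_forallq_reindex_meet[of B "Prod (base P) X A" "\<phi>_at A"
        "reindex P (Prod (base P) (Prod (base P) X A) B) ?AB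
          (prod_map (base P) (Prod (base P) X A) A B B (Pr2 (base P) X A) (Id (base P) B)) \<beta>"]
    by (simp add: kforall_def Pr1_assoc Pr2_assoc beck_chevalley)
  moreover have "kforall B A ?\<beta> = forallq (kleisli P X \<phi>) B A ?\<beta>"
    using 4 kleisli_map_mem[of ?AB \<beta>] by (intro forallq_kleisli[symmetric]) simp_all
  ultimately show ?case
    \<comment> \<open>The lift of the comparison is an identity, so the reindexing along it
      disappears.\<close>
    using 4 by (simp add: prod_comparison_kleisli)
qed

lemma frobenius_forall_kleisli:
  assumes "frobenius_forall P"
  shows "frobenius_forall (kleisli P X \<phi>)"
  unfolding frobenius_forall_def
proof (intro conjI ballI, goal_cases)
  case 1
  then show ?case by (rule primary_doctrine_kleisli)
next
  case 2
  then show ?case by (rule universal_doctrine_kleisli)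
next
  case (3 B A \<gamma> \<beta>)
  let ?XA = "Prod (base P) X A"
  let ?L = "Prod (base P) ?XA B" and ?R = "Prod (base P) X (Prod (base P) A B)"
  let ?p = "reindex P ?L ?XA (Pr1 (base P) ?XA B)"
  let ?k = "reindex (kleisli P X \<phi>) (Prod (base P) A B) A (Pr1 (kleisli_cat (base P) X) A B)"
  let ?\<beta> = "reindex P ?L ?R (assoc A B) \<beta>"
  interpret XA: lower_semilattice "fib P ?XA"
    using 3 by (simp add: fib_meet)
  interpret R: lower_semilattice "fib P ?R"
    using 3 by (simp add: fib_meet)
  have k: "?k \<delta> = reindex P ?R ?L (assoc_inv A B) (?p \<delta>)" if "\<delta> \<in> carrier (fib P ?XA)" for \<delta>
    using 3 that by (simp add: Pr1_assoc_inv)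
  \<comment> \<open>As \<gamma> lies below \<open>\<phi>_at A\<close>, it absorbs the \<phi>
    conjunct of \<open>kforall\<close>.\<close>
  have "\<gamma> \<sqinter>\<^bsub>fib P ?XA\<^esub> kforall B A \<beta> = \<gamma> \<sqinter>\<^bsub>fib P ?XA\<^esub> forallq P B ?XA ?\<beta>"
  proof (rule XA.eq_if_same_lower_bounds)
    show "\<delta> \<sqsubseteq>\<^bsub>fib P ?XA\<^esub> \<gamma> \<sqinter>\<^bsub>fib P ?XA\<^esub> kforall B A \<beta> \<longleftrightarrow>
        \<delta> \<sqsubseteq>\<^bsub>fib P ?XA\<^esub> \<gamma> \<sqinter>\<^bsub>fib P ?XA\<^esub> forallq P B ?XA ?\<beta>"
      if "\<delta> \<in> carrier (fib P ?XA)" for \<delta>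
      using 3 that XA.le_trans[of \<delta> \<gamma> "\<phi>_at A"] by (auto simp: kforall_def XA.le_meet_iff)
  qed (use 3 kforall_mem(1) in simp_all)
  then have "?k (\<gamma> \<sqinter>\<^bsub>fib P ?XA\<^esub> kforall B A \<beta>)
      = reindex P ?R ?L (assoc_inv A B) (?p (\<gamma> \<sqinter>\<^bsub>fib P ?XA\<^esub> forallq P B ?XA ?\<beta>))"
    \<comment> \<open>Kleisli reindexing stays folded so that \<open>k\<close> applies to the whole
      meet.\<close>
    using 3 k by (simp del: kleisli_sel(3) kleisli_cat_sel(7) reindex_meet)
  \<comment> \<open>Frobenius reciprocity of \<open>P\<close> at the object
    \<open>X x A\<close>.\<close>
  also have "?p (\<gamma> \<sqinter>\<^bsub>fib P ?XA\<^esub> forallq P B ?XA ?\<beta>) = ?p \<gamma> \<sqinter>\<^bsub>fib P ?L\<^esub> ?\<beta>"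
    using 3 assms by (simp add: frobenius_forall_def del: reindex_meet)
  \<comment> \<open>Reindexing distributes over the meet, and \<open>assoc_inv\<close> cancels
    \<open>assoc\<close> on \<beta>.\<close>
  also have "reindex P ?R ?L (assoc_inv A B) (?p \<gamma> \<sqinter>\<^bsub>fib P ?L\<^esub> ?\<beta>) = ?k \<gamma> \<sqinter>\<^bsub>fib P ?R\<^esub> \<beta>"
    using 3 by (simp add: Pr1_assoc_inv assoc_assoc_inv)
  finally have *: "?k (\<gamma> \<sqinter>\<^bsub>fib P ?XA\<^esub> kforall B A \<beta>) = ?k \<gamma> \<sqinter>\<^bsub>fib P ?R\<^esub> \<beta>" .
  \<comment> \<open>Arguments of a Kleisli meet must lie in the down-set before
    \<open>meet_down\<close> replaces it by the meet of \<open>P\<close>.\<close>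
  have "?k \<gamma> \<in> carrier (fib P ?R)" "?k \<gamma> \<sqsubseteq>\<^bsub>fib P ?R\<^esub> \<phi>_at (Prod (base P) A B)"
    using 3 by (simp_all add: reindex_lift_le)
  with 3 * show ?case
    by (simp add: forallq_kleisli kforall_mem XA.meet_down R.meet_down
        del: kleisli_sel(3) kleisli_cat_sel(7,8) reindex_meet)
qed

end

theorem proposition5p6:
  fixes P :: "('o, 'm, 'p) doctrine" and X :: 'o and \<phi> :: 'p
  assumes "primary_doctrine P"
    and "X \<in> Obj (base P)"
    and "\<phi> \<in> carrier (fib P X)"
    and "universal_doctrine P"
  shows "universal_doctrine (kleisli P X \<phi>) \<and>
    universal_hom P (kleisli P X \<phi>) (kleisli_map P X \<phi>) \<and>
    (frobenius_forall P \<longrightarrow> frobenius_forall (kleisli P X \<phi>))"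
proof -
  interpret kleisli_universal P X \<phi>
    using assms by (simp add: kleisli_universal_def kleisli_universal_axioms_def
        kleisli_doctrine_def kleisli_doctrine_axioms_def)
  show ?thesis
    using universal_doctrine_kleisli universal_hom_kleisli frobenius_forall_kleisli by blast
qed

end
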